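(* Let $\mathcal{T}=(\mathcal{V},\mathcal{E})$ be a tree with $\mathcal{V}=\{1,\ldots,d\}$, let $\boldsymbol{q}=(q_v,\,v\in\mathcal{V})\in(0,1)^d$ and $\boldsymbol{\alpha}=(\alpha_e,\,e\in\mathcal{E})\in\Lambda(\boldsymbol{q})$, and let $\boldsymbol{J}=(J_v,\,v\in\mathcal{V})$ be the tree-structured Ising model on $\mathcal{T}$ mean-parameterized by $\boldsymbol{q}$ and $\boldsymbol{\alpha}$. Choose a vertex $r\in\mathcal{V}$ as the root of the tree, and let $\sigma_{(u,v)}=\sqrt{q_uq_v(1-q_u)(1-q_v)}$ for $u,v\in\mathcal{V}$. Then the joint probability generating function of $\boldsymbol{J}$ is $$\mathcal{P}_{\boldsymbol{J}}(\boldsymbol{t})=(1-q_r)\prod_{i\in\mathrm{ch}(r)}\zeta_i^{\mathcal{T}_r}(\boldsymbol{t}_{i\mathrm{dsc}(i)})+q_rt_r\prod_{i\in\mathrm{ch}(r)}\xi_i^{\mathcal{T}_r}(\boldsymbol{t}_{i\mathrm{dsc}(i)}),\quad\boldsymbol{t}\in[-1,1]^d,$$ where, for $v\in\mathrm{dsc}(r)$, $\zeta_v^{\mathcal{T}_r}$ and $\xi_v^{\mathcal{T}_r}$ are defined recursively by $$\zeta_v^{\mathcal{T}_r}(\boldsymbol{t}_{v\mathrm{dsc}(v)})=\left(1-q_v+\frac{\alpha_{(\mathrm{pa}(v),v)}\sigma_{(\mathrm{pa}(v),v)}}{1-q_{\mathrm{pa}(v)}}\right)\prod_{i\in\mathrm{ch}(v)}\zeta_i^{\mathcal{T}_r}(\boldsymbol{t}_{i\mathrm{dsc}(i)})+\left(q_v-\frac{\alpha_{(\mathrm{pa}(v),v)}\sigma_{(\mathrm{pa}(v),v)}}{1-q_{\mathrm{pa}(v)}}\right)t_v\prod_{i\in\mathrm{ch}(v)}\xi_i^{\mathcal{T}_r}(\boldsymbol{t}_{i\mathrm{dsc}(i)}),$$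 $$\xi_v^{\mathcal{T}_r}(\boldsymbol{t}_{v\mathrm{dsc}(v)})=\left(1-q_v-\frac{\alpha_{(\mathrm{pa}(v),v)}\sigma_{(\mathrm{pa}(v),v)}}{q_{\mathrm{pa}(v)}}\right)\prod_{i\in\mathrm{ch}(v)}\zeta_i^{\mathcal{T}_r}(\boldsymbol{t}_{i\mathrm{dsc}(i)})+\left(q_v+\frac{\alpha_{(\mathrm{pa}(v),v)}\sigma_{(\mathrm{pa}(v),v)}}{q_{\mathrm{pa}(v)}}\right)t_v\prod_{i\in\mathrm{ch}(v)}\xi_i^{\mathcal{T}_r}(\boldsymbol{t}_{i\mathrm{dsc}(i)}),$$ products over an empty set being equal to $1$.
   Context: The joint probability generating function is $\mathcal{P}_{\boldsymbol{J}}(\boldsymbol{t})=\mathrm{E}[t_1^{J_1}\cdots t_d^{J_d}]$ (with $0^0=1$). Rooted tree $\mathcal{T}_r$: the descendants $\mathrm{dsc}(u)$ of $u$ are the vertices $j\neq u$ such that $u$ lies on the path from $j$ to the root $r$; the children $\mathrm{ch}(u)$ are the descendants of $u$ that are neighbors of $u$; the parent $\mathrm{pa}(u)$ of $u\neq r$ is its unique neighbor that is not a child. $\boldsymbol{t}_{v\mathrm{dsc}(v)}=(t_j,\,j\in\{v\}\cup\mathrm{dsc}(v))$. $\Lambda(\boldsymbol{q})$ is the set of $\boldsymbol{\alpha}=(\alpha_e,e\in\mathcal{E})$ such that, for every edge $(u,v)\in\mathcal{E}$, $$-\min\left(\sqrt{\tfrac{q_uq_v}{(1-q_u)(1-q_v)}},\sqrt{\tfrac{(1-q_u)(1-q_v)}{q_uq_v}}\right)<\alpha_{(u,v)}<\min\left(\sqrt{\tfrac{(1-q_u)q_v}{q_u(1-q_v)}},\sqrt{\tfrac{q_u(1-q_v)}{(1-q_u)q_v}}\right).$$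 Tree-structured Ising model mean-parameterized by $\boldsymbol{q},\boldsymbol{\alpha}$ on $\mathcal{T}$: the random vector $\boldsymbol{J}$ on $\{0,1\}^d$ whose pmf has the form $p_{\boldsymbol{J}}(\boldsymbol{x})=\exp(\sum_{v\in\mathcal{V}}\eta_vx_v+\sum_{(u,v)\in\mathcal{E}}\eta_{(u,v)}x_ux_v-A(\boldsymbol{\eta}))$ for real parameters $\boldsymbol{\eta}$ and normalizing constant $A(\boldsymbol{\eta})$, with $\mathrm{E}[J_v]=q_v$ for all $v\in\mathcal{V}$ and Pearson correlation $\mathrm{Corr}(J_u,J_v)=\alpha_{(u,v)}$ for all edges $(u,v)\in\mathcal{E}$. Equivalently, for any choice of root $r\in\mathcal{V}$, with $p_v(x)=q_v^{x}(1-q_v)^{1-x}$ and $\sigma_{(u,v)}=\sqrt{q_uq_v(1-q_u)(1-q_v)}$, $$p_{\boldsymbol{J}}(\boldsymbol{x})=p_r(x_r)\prod_{v\neq r}\frac{p_v(x_v)\,p_{\mathrm{pa}(v)}(x_{\mathrm{pa}(v)})+\alpha_{(\mathrm{pa}(v),v)}(-1)^{x_v+x_{\mathrm{pa}(v)}}\sigma_{(\mathrm{pa}(v),v)}}{p_{\mathrm{pa}(v)}(x_{\mathrm{pa}(v)})},\quad\boldsymbol{x}\in\{0,1\}^d.$$ *)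

theory Defs
  imports "HOL-Probability.Probability"
begin

section \<open>Trees and rooted trees\<close>

text \<open>
  Edges are unordered, i.e. two-element sets of vertices, so that a family indexed by edges
  is a function on vertex sets and \<open>\<alpha> {u, v} = \<alpha> {v, u}\<close>. Walks, paths and cycles are lists
  of vertices; the closing edge of a cycle is not repeated in the list.
\<close>

definition is_path :: "'v set \<Rightarrow> 'v set set \<Rightarrow> 'v \<Rightarrow> 'v list \<Rightarrow> 'v \<Rightarrow> bool" where
  "is_path V E u p v \<longleftrightarrow> p \<noteq> [] \<and> hd p = u \<and> last p = v \<and> set p \<subseteq> V \<and> distinct p \<and>
     successively (\<lambda>x y. {x, y} \<in> E) p"

definition is_cycle :: "'v set \<Rightarrow> 'v set set \<Rightarrow> 'v list \<Rightarrow> bool" where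
  "is_cycle V E p \<longleftrightarrow> 3 \<le> length p \<and> set p \<subseteq> V \<and> distinct p \<and>
     successively (\<lambda>x y. {x, y} \<in> E) p \<and> {last p, hd p} \<in> E"

locale tree_graph =
  fixes V :: "'v set" and E :: "'v set set"
  assumes finite_V: "finite V"
    and nonempty_V: "V \<noteq> {}"
    and edges: "e \<in> E \<Longrightarrow> e \<subseteq> V \<and> card e = 2"
    and connected: "u \<in> V \<Longrightarrow> v \<in> V \<Longrightarrow> \<exists>p. is_path V E u p v"
    and acyclic: "\<not> is_cycle V E p"
begin

lemma path_unique: "is_path V E u p v \<Longrightarrow> is_path V E u p' v \<Longrightarrow> p = p'"
proof (induction p arbitrary: u p')
  case Nil
  then show ?case by (simp add: is_path_def)
next
  case (Cons a p)
  from Cons.prems obtain q where p': "p' = a # q"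
    by (cases p') (auto simp: is_path_def)
  have u: "u = a" using Cons.prems by (simp add: is_path_def)
  show ?case
  proof (cases "p = [] \<or> q = []")
    case True
    then show ?thesis
      using Cons.prems unfolding p' is_path_def
      by (auto split: if_splits dest: last_in_set)
  next
    case False
    hence ne: "p \<noteq> []" "q \<noteq> []" by auto
    have P: "last p = v" "set p \<subseteq> V" "distinct p" "a \<notin> set p" "a \<in> V"
        "successively (\<lambda>x y. {x, y} \<in> E) p" "{a, hd p} \<in> E"
      and Q: "last q = v" "set q \<subseteq> V" "distinct q" "a \<notin> set q"
        "successively (\<lambda>x y. {x, y} \<in> E) q" "{a, hd q} \<in> E"
      using Cons.prems ne unfolding p' is_path_def by (auto simp: successively_Cons)
    show ?thesis
    proof (cases "hd p = hd q")
      case True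
      have "is_path V E (hd p) p v" "is_path V E (hd p) q v"
        using P Q ne True by (auto simp: is_path_def)
      from Cons.IH[OF this] show ?thesis by (simp add: p')
    next
      case hd: False
      have "\<exists>x\<in>set p. x \<in> set q"
        using P(1) Q(1) ne last_in_set by metis
      then obtain p1 w p2 where p: "p = p1 @ w # p2" "w \<in> set q" "\<forall>x\<in>set p1. x \<notin> set q"
        using split_list_first_prop[of p "\<lambda>x. x \<in> set q"] by auto
      then obtain q1 q2 where q: "q = q1 @ w # q2"
        by (auto dest: split_list)
      let ?c = "a # (p1 @ [w]) @ rev q1"
      have "successively (\<lambda>x y. {x, y} \<in> E) (rev (q1 @ [w]))"
        using Q(5) unfolding q successively_rev
        by (auto simp: successively_append_iff insert_commute)
      hence s1: "successively (\<lambda>x y. {x, y} \<in> E) (w # rev q1)" by simp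
      have "successively (\<lambda>x y. {x, y} \<in> E) (a # p1 @ [w])"
        using P(6,7) unfolding p(1)
        by (cases p1) (auto simp: successively_append_iff successively_Cons hd_append)
      with s1 have "successively (\<lambda>x y. {x, y} \<in> E) ?c"
        by (auto simp: successively_append_iff successively_Cons hd_append)
      moreover have "distinct ?c"
        using P Q p q by auto
      moreover have "set ?c \<subseteq> V" using P Q p q by auto
      moreover have "3 \<le> length ?c"
      proof (rule ccontr)
        assume "\<not> ?thesis"
        hence "p1 = []" "q1 = []" by (auto simp: Suc_le_eq)
        with hd p q show False by simp
      qed
      moreover have "{last ?c, hd ?c} \<in> E"
        using Q(6) unfolding q
        by (cases q1) (auto simp: insert_commute)
      ultimately have "is_cycle V E ?c" unfolding is_cycle_def by blast
      with acyclic show ?thesis by blast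
    qed
  qed
qed

end

locale rooted_tree = tree_graph V E for V :: "'v set" and E :: "'v set set" +
  fixes r :: 'v
  assumes root: "r \<in> V"
begin

definition root_path :: "'v \<Rightarrow> 'v list" where
  "root_path j = (THE p. is_path V E j p r)"

definition dsc :: "'v \<Rightarrow> 'v set" where
  "dsc u = {j \<in> V. j \<noteq> u \<and> u \<in> set (root_path j)}"

definition ch :: "'v \<Rightarrow> 'v set" where
  "ch u = {j \<in> dsc u. {u, j} \<in> E}"

definition pa :: "'v \<Rightarrow> 'v" where
  "pa u = (THE v. {u, v} \<in> E \<and> v \<notin> ch u)"

lemma root_path: "j \<in> V \<Longrightarrow> is_path V E j (root_path j) r"
  unfolding root_path_def using connected[OF _ root, of j] path_unique
  by (metis (no_types, lifting) theI)

lemma root_path_eq: "is_path V E j p r \<Longrightarrow> root_path j = p"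
  unfolding root_path_def using path_unique by blast

lemma dsc_split:
  assumes "j \<in> dsc u"
  obtains p where "p \<noteq> []" "root_path j = p @ root_path u" "u \<in> V" "j \<in> V"
proof -
  from assms have j: "j \<in> V" "j \<noteq> u" "u \<in> set (root_path j)" by (auto simp: dsc_def)
  then obtain p p' where p: "root_path j = p @ u # p'" by (auto dest: split_list)
  have jp: "is_path V E j (p @ u # p') r" using root_path[OF j(1)] p by simp
  hence "is_path V E u (u # p') r"
    unfolding is_path_def by (auto simp: successively_append_iff)
  hence "root_path u = u # p'" by (rule root_path_eq)
  moreover have "p \<noteq> []" using jp j(2) by (auto simp: is_path_def)
  moreover have "u \<in> V" using jp by (auto simp: is_path_def)
  ultimately show ?thesis using that[of p] p j(1) by simp
qed

lemma length_root_path_less: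
  assumes "j \<in> dsc u"
  shows "card V - length (root_path j) < card V - length (root_path u)"
proof -
  from assms obtain p where p: "p \<noteq> []" "root_path j = p @ root_path u" "j \<in> V"
    by (rule dsc_split)
  have "length (root_path j) \<le> card V"
    using root_path[OF p(3)] finite_V card_mono distinct_card
    unfolding is_path_def by metis
  moreover have "length (root_path u) < length (root_path j)"
    using p by simp
  ultimately show ?thesis by linarith
qed

lemma dsc_trans:
  assumes "i \<in> dsc v" "j \<in> dsc i"
  shows "j \<in> dsc v"
proof -
  from assms(1) obtain p where p: "p \<noteq> []" "root_path i = p @ root_path v" "v \<in> V"
    by (rule dsc_split)
  from assms(2) obtain p' where p': "p' \<noteq> []" "root_path j = p' @ root_path i" "j \<in> V"
    by (rule dsc_split)
  have v: "v \<in> set (root_path v)" 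
    using root_path[OF p(3)] hd_in_set unfolding is_path_def by metis
  have "j \<noteq> v" using p p' by auto
  with v p p' show ?thesis by (simp add: dsc_def)
qed

end


section \<open>The recursion on the rooted tree\<close>

definition edge_sigma :: "('v \<Rightarrow> real) \<Rightarrow> 'v \<Rightarrow> 'v \<Rightarrow> real" where
  "edge_sigma q u v = sqrt (q u * q v * (1 - q u) * (1 - q v))"

context rooted_tree
begin

text \<open>
  The argument \<open>t\<close> is the whole vector; by \<open>zeta_xi_cong\<close> below, \<open>zeta\<close> and \<open>xi\<close> at \<open>v\<close>
  depend only on its coordinates in \<open>{v} \<union> dsc v\<close>. At \<open>v = r\<close> the vertex \<open>pa v\<close> does not
  exist and the values are meaningless; only vertices in \<open>dsc r\<close> are of interest.
\<close>

function zeta :: "('v \<Rightarrow> real) \<Rightarrow> ('v set \<Rightarrow> real) \<Rightarrow> ('v \<Rightarrow> real) \<Rightarrow> 'v \<Rightarrow> real"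
  and xi :: "('v \<Rightarrow> real) \<Rightarrow> ('v set \<Rightarrow> real) \<Rightarrow> ('v \<Rightarrow> real) \<Rightarrow> 'v \<Rightarrow> real" where
  "zeta q \<alpha> t v =
     (1 - q v + \<alpha> {pa v, v} * edge_sigma q (pa v) v / (1 - q (pa v))) * (\<Prod>i\<in>ch v. zeta q \<alpha> t i)
     + (q v - \<alpha> {pa v, v} * edge_sigma q (pa v) v / (1 - q (pa v))) * t v * (\<Prod>i\<in>ch v. xi q \<alpha> t i)"
| "xi q \<alpha> t v =
     (1 - q v - \<alpha> {pa v, v} * edge_sigma q (pa v) v / q (pa v)) * (\<Prod>i\<in>ch v. zeta q \<alpha> t i)
     + (q v + \<alpha> {pa v, v} * edge_sigma q (pa v) v / q (pa v)) * t v * (\<Prod>i\<in>ch v. xi q \<alpha> t i)"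
  by pat_completeness auto

termination
  by (relation "Wellfounded.measure (\<lambda>x. case x of Inl (q, \<alpha>, t, v) \<Rightarrow> card V - length (root_path v)
                                                | Inr (q, \<alpha>, t, v) \<Rightarrow> card V - length (root_path v))")
     (auto simp: ch_def intro: length_root_path_less)

declare zeta.simps [simp del] xi.simps [simp del]

lemma zeta_xi_cong:
  assumes "\<And>j. j \<in> {v} \<union> dsc v \<Longrightarrow> t j = t' j"
  shows "zeta q \<alpha> t v = zeta q \<alpha> t' v \<and> xi q \<alpha> t v = xi q \<alpha> t' v"
  using assms
proof (induction "card V - length (root_path v)" arbitrary: v rule: less_induct)
  case less
  have IH: "zeta q \<alpha> t i = zeta q \<alpha> t' i \<and> xi q \<alpha> t i = xi q \<alpha> t' i" if "i \<in> ch v" for i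
  proof (rule less.hyps)
    have i: "i \<in> dsc v" using that by (simp add: ch_def)
    show "card V - length (root_path i) < card V - length (root_path v)"
      by (rule length_root_path_less[OF i])
    show "t j = t' j" if "j \<in> {i} \<union> dsc i" for j
      using that less.prems i dsc_trans[OF i] by auto
  qed
  have "t v = t' v" using less.prems by simp
  with IH show ?case
    by (simp add: zeta.simps[of _ _ _ v] xi.simps[of _ _ _ v] cong: prod.cong)
qed

end


section \<open>The tree-structured Ising model\<close>

definition Lambda_set :: "'v set set \<Rightarrow> ('v \<Rightarrow> real) \<Rightarrow> ('v set \<Rightarrow> real) set" where
  "Lambda_set E q = {\<alpha>. \<forall>u v. {u, v} \<in> E \<longrightarrow>
     - min (sqrt (q u * q v / ((1 - q u) * (1 - q v)))) (sqrt ((1 - q u) * (1 - q v) / (q u * q v)))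
       < \<alpha> {u, v} \<and>
     \<alpha> {u, v}
       < min (sqrt ((1 - q u) * q v / (q u * (1 - q v)))) (sqrt (q u * (1 - q v) / ((1 - q u) * q v)))}"

text \<open>For an edge \<open>e = {u, v}\<close> the product over \<open>e\<close> is the interaction term \<open>x u * x v\<close>.\<close>

definition ising_exponent ::
  "'v set \<Rightarrow> 'v set set \<Rightarrow> ('v \<Rightarrow> real) \<Rightarrow> ('v set \<Rightarrow> real) \<Rightarrow> ('v \<Rightarrow> nat) \<Rightarrow> real" where
  "ising_exponent V E \<eta> \<theta> x = (\<Sum>v\<in>V. \<eta> v * real (x v)) + (\<Sum>e\<in>E. \<theta> e * (\<Prod>v\<in>e. real (x v)))"

definition log_partition ::
  "'v set \<Rightarrow> 'v set set \<Rightarrow> ('v \<Rightarrow> real) \<Rightarrow> ('v set \<Rightarrow> real) \<Rightarrow> real" where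
  "log_partition V E \<eta> \<theta> = ln (\<Sum>x\<in>(V \<rightarrow>\<^sub>E {0, 1}). exp (ising_exponent V E \<eta> \<theta> x))"

context prob_space
begin

definition correlation :: "('a \<Rightarrow> real) \<Rightarrow> ('a \<Rightarrow> real) \<Rightarrow> real" where
  "correlation X Y =
     expectation (\<lambda>\<omega>. (X \<omega> - expectation X) * (Y \<omega> - expectation Y))
       / sqrt (variance X * variance Y)"

definition ising_model ::
  "'v set \<Rightarrow> 'v set set \<Rightarrow> ('v \<Rightarrow> real) \<Rightarrow> ('v set \<Rightarrow> real) \<Rightarrow> ('v \<Rightarrow> 'a \<Rightarrow> nat) \<Rightarrow> bool" where
  "ising_model V E q \<alpha> J \<longleftrightarrow>
     (\<forall>v\<in>V. random_variable (count_space {0, 1}) (J v)) \<and>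
     (\<exists>\<eta> \<theta>. \<forall>x \<in> V \<rightarrow>\<^sub>E {0, 1}.
        prob {\<omega> \<in> space M. \<forall>v\<in>V. J v \<omega> = x v}
          = exp (ising_exponent V E \<eta> \<theta> x - log_partition V E \<eta> \<theta>)) \<and>
     (\<forall>v\<in>V. expectation (\<lambda>\<omega>. real (J v \<omega>)) = q v) \<and>
     (\<forall>u v. {u, v} \<in> E \<longrightarrow> correlation (\<lambda>\<omega>. real (J u \<omega>)) (\<lambda>\<omega>. real (J v \<omega>)) = \<alpha> {u, v})"

definition joint_pgf :: "'v set \<Rightarrow> ('v \<Rightarrow> 'a \<Rightarrow> nat) \<Rightarrow> ('v \<Rightarrow> real) \<Rightarrow> real" where
  "joint_pgf V J t = expectation (\<lambda>\<omega>. \<Prod>v\<in>V. t v ^ J v \<omega>)"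

end

end

theory Submission
  imports Defs
begin

text \<open>
  On a tree the Gibbs weight \<open>exp (ising_exponent V E \<eta> \<theta> x)\<close> is a product of one factor per vertex
  and one factor per parent-child pair. The factors inside the branch of a vertex \<open>v\<close>, i.e. \<open>v\<close>
  together with its descendants, interact with the rest of the tree only through the state of \<open>v\<close>.
  Summing them over the states of the descendants therefore gives a function \<open>branch_sum\<close> of the
  state of \<open>v\<close> alone, and these functions obey the sum-product recursion \<open>branch_sum_rec\<close> from the
  leaves to the root.

  Inserting \<open>t v\<close> to the power of the state into the vertex factors turns the partition function into
  the numerator of the generating function, so that the generating function is a quotient of two
  partition functions that satisfy the same recursion. Dividing the recursion with \<open>t\<close> by the one
  without \<open>t\<close> leaves only the normalized edge weights \<open>transition\<close>, which play the role of the
  conditional law of a child given its parent (\<open>branch_sum_zeta_xi\<close>).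

  It remains to express these transitions by \<open>q\<close> and \<open>\<alpha>\<close>; the natural parameters \<open>\<eta>\<close> and \<open>\<theta>\<close>
  never have to be computed. Marginals are partition functions in which some vertices
  are pinned to a state. Pinning a child on top of its pinned parent multiplies the branch sum of the
  parent by the transition, and since the branch sums of its ancestors are linear in it, the
  partition function is multiplied by the same factor (\<open>partition_sum_pin_edge\<close>). On the other hand,
  the law of two binary variables is determined by their means and their correlation
  (\<open>binary_expectation_product\<close>), and comparing the two yields exactly the coefficients of
  \<open>zeta\<close> and \<open>xi\<close>.
\<close>

section \<open>Structure of a rooted tree\<close>

context rooted_tree
begin

lemma ch_subset_dsc: "ch v \<subseteq> dsc v"
  by (auto simp: ch_def)

lemma dsc_subset_V: "dsc v \<subseteq> V"
  by (auto simp: dsc_def)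

lemma finite_dsc: "finite (dsc v)"
  using dsc_subset_V finite_V finite_subset by metis

lemma finite_ch: "finite (ch v)"
  using ch_subset_dsc finite_dsc finite_subset by metis

lemma in_root_path_self: "v \<in> V \<Longrightarrow> v \<in> set (root_path v)"
  using root_path hd_in_set unfolding is_path_def by metis

lemma hd_root_path: "v \<in> V \<Longrightarrow> hd (root_path v) = v"
  using root_path unfolding is_path_def by metis

lemma root_path_child:
  assumes "v \<in> V" "i \<in> V" "{v, i} \<in> E" "i \<notin> set (root_path v)"
  shows "root_path i = i # root_path v"
proof (rule root_path_eq)
  show "is_path V E i (i # root_path v) r"
    using root_path[OF assms(1)] assms
    by (auto simp: is_path_def successively_Cons insert_commute)
qed

lemma edge_vertices: "{u, v} \<in> E \<Longrightarrow> u \<in> V \<and> v \<in> V \<and> u \<noteq> v"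
  using edges[of "{u, v}"] by (auto simp: card_2_iff doubleton_eq_iff)

text \<open>
  Adjacency and descent together say that the path to the root grows by one vertex. In this form
  uniqueness of parents and disjointness of branches become statements about lists.
\<close>

lemma ch_iff: "i \<in> ch v \<longleftrightarrow> v \<in> V \<and> i \<in> V \<and> root_path i = i # root_path v"
proof
  assume i: "i \<in> ch v"
  hence E: "{v, i} \<in> E" and d: "i \<in> dsc v" by (auto simp: ch_def)
  from d obtain p where p: "p \<noteq> []" "root_path i = p @ root_path v" "v \<in> V" "i \<in> V"
    by (rule dsc_split)
  have "i \<notin> set (root_path v)"
  proof -
    have "distinct (p @ root_path v)" "hd p = i"
      using root_path[OF p(4)] p by (auto simp: is_path_def)
    with p(1) show ?thesis using hd_in_set[of p] by auto
  qed
  with root_path_child p E show "v \<in> V \<and> i \<in> V \<and> root_path i = i # root_path v" by blast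
next
  assume i: "v \<in> V \<and> i \<in> V \<and> root_path i = i # root_path v"
  hence P: "is_path V E i (i # root_path v) r" using root_path[of i] by simp
  hence "{v, i} \<in> E" using hd_root_path[of v] i in_root_path_self[of v]
    by (auto simp: is_path_def successively_Cons insert_commute)
  moreover have "i \<noteq> v" using P in_root_path_self[of v] i by (auto simp: is_path_def)
  ultimately show "i \<in> ch v" using i in_root_path_self[of v] by (auto simp: ch_def dsc_def)
qed

lemma edge_child:
  assumes "{u, v} \<in> E"
  shows "u \<in> ch v \<or> v \<in> ch u"
proof (cases "u \<in> set (root_path v)")
  case True
  with assms edge_vertices[OF assms] show ?thesis by (auto simp: ch_def dsc_def)
next
  case False
  with assms edge_vertices[OF assms] root_path_child[of v u] show ?thesis
    by (auto simp: ch_iff insert_commute)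
qed

lemma ch_asym: "i \<in> ch v \<Longrightarrow> v \<notin> ch i"
  by (auto simp: ch_iff)

lemma ch_parent_unique: "i \<in> ch v \<Longrightarrow> i \<in> ch w \<Longrightarrow> v = w"
  using hd_root_path unfolding ch_iff by (metis list.inject)

lemma pa_child:
  assumes "i \<in> ch v"
  shows "pa i = v"
  unfolding pa_def
proof (rule the_equality)
  show "{i, v} \<in> E \<and> v \<notin> ch i"
    using assms ch_asym by (auto simp: ch_def insert_commute)
  show "w = v" if "{i, w} \<in> E \<and> w \<notin> ch i" for w
    using that edge_child[of i w] ch_parent_unique assms by blast
qed

lemma dsc_root: "dsc r = V - {r}"
proof -
  have "r \<in> set (root_path j)" if "j \<in> V" for j
    using root_path[OF that] last_in_set unfolding is_path_def by metis
  thus ?thesis by (auto simp: dsc_def)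
qed

lemma dsc_irrefl: "v \<notin> dsc v"
  by (simp add: dsc_def)

text \<open>
  The path from a descendant \<open>j\<close> of \<open>v\<close> enters \<open>v\<close> through a child, namely the last vertex before the
  common suffix \<open>root_path v\<close>.
\<close>

lemma dsc_eq_UN_children: "dsc v = (\<Union>i\<in>ch v. insert i (dsc i))"
proof
  show "(\<Union>i\<in>ch v. insert i (dsc i)) \<subseteq> dsc v"
    using ch_subset_dsc dsc_trans by blast
  show "dsc v \<subseteq> (\<Union>i\<in>ch v. insert i (dsc i))"
  proof
    fix j assume "j \<in> dsc v"
    then obtain p where p: "p \<noteq> []" "root_path j = p @ root_path v" "v \<in> V" "j \<in> V"
      by (rule dsc_split)
    define i where "i = last p"
    have eq: "root_path j = butlast p @ i # root_path v"
      using p by (simp add: i_def)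
    hence P: "is_path V E j (butlast p @ i # root_path v) r"
      using root_path[OF p(4)] by simp
    hence "is_path V E i (i # root_path v) r"
      by (auto simp: is_path_def successively_append_iff)
    hence "root_path i = i # root_path v" by (rule root_path_eq)
    moreover have "i \<in> V" using P by (auto simp: is_path_def)
    ultimately have "i \<in> ch v" using p by (simp add: ch_iff)
    moreover have "i \<in> set (root_path j)" unfolding eq by simp
    hence "j \<in> insert i (dsc i)" using p(4) by (auto simp: dsc_def)
    ultimately show "j \<in> (\<Union>i\<in>ch v. insert i (dsc i))" by blast
  qed
qed

lemma root_path_suffix:
  assumes "i \<in> V" "j \<in> insert i (dsc i)"
  shows "\<exists>p. root_path j = p @ root_path i"
  using assms by (auto elim: dsc_split)

text \<open>
  A common vertex of two branches would have both root paths as suffixes of its own; they have equal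
  length, so they would coincide.
\<close>

lemma child_branches_disjoint:
  assumes "i \<in> ch v" "k \<in> ch v" "i \<noteq> k"
  shows "insert i (dsc i) \<inter> insert k (dsc k) = {}"
proof (rule ccontr)
  assume "\<not> ?thesis"
  then obtain j where j: "j \<in> insert i (dsc i)" "j \<in> insert k (dsc k)" by blast
  have r: "root_path i = i # root_path v" "root_path k = k # root_path v" "i \<in> V" "k \<in> V"
    using assms by (auto simp: ch_iff)
  obtain p p' where "root_path j = p @ i # root_path v" "root_path j = p' @ k # root_path v"
    using root_path_suffix[OF r(3) j(1)] root_path_suffix[OF r(4) j(2)] r by auto
  thus False using assms(3) by (auto simp: append_eq_append_conv)
qed

lemma not_in_child_branch: "i \<in> ch v \<Longrightarrow> v \<notin> insert i (dsc i)"
  using dsc_eq_UN_children[of v] dsc_irrefl[of v] by blast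

lemma child_in_V: "i \<in> ch v \<Longrightarrow> i \<in> V"
  by (simp add: ch_iff)

text \<open>
  Induction from the leaves towards the root: it is well-founded because root paths get longer with
  each generation and cannot exceed \<open>card V\<close>.
\<close>

lemma tree_induct [consumes 1, case_names vertex]:
  assumes "v \<in> V"
    and step: "\<And>v. v \<in> V \<Longrightarrow> (\<And>i. i \<in> ch v \<Longrightarrow> P i) \<Longrightarrow> P v"
  shows "P v"
  using assms(1)
proof (induction "card V - length (root_path v)" arbitrary: v rule: less_induct)
  case less
  show ?case
  proof (rule step[OF less.prems])
    show "P i" if "i \<in> ch v" for i
      using that ch_subset_dsc length_root_path_less child_in_V by (intro less.hyps) auto
  qed
qed

text \<open>
  The second vertex on the path from \<open>j\<close> to the root is its parent, and that path runs inside the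
  branch of \<open>v\<close> until it reaches \<open>v\<close>.
\<close>

lemma parent_in_branch:
  assumes "j \<in> dsc v"
  shows "\<exists>w\<in>insert v (dsc v). j \<in> ch w"
proof -
  from assms obtain p where p: "p \<noteq> []" "root_path j = p @ root_path v" "v \<in> V" "j \<in> V"
    by (rule dsc_split)
  have P: "is_path V E j (p @ root_path v) r" using root_path[OF p(4)] p by simp
  obtain p' where p': "p = j # p'" using P p by (cases p) (auto simp: is_path_def)
  define w where "w = hd (p' @ root_path v)"
  have ne: "root_path v \<noteq> []" using in_root_path_self[OF p(3)] by auto
  have Q: "is_path V E w (p' @ root_path v) r" using P ne unfolding p' w_def
    by (auto simp: is_path_def successively_Cons)
  have w: "w \<in> V" using Q hd_in_set unfolding is_path_def by blast
  have rw: "root_path w = p' @ root_path v" by (rule root_path_eq[OF Q])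
  hence "j \<in> ch w" using p p' w by (simp add: ch_iff)
  moreover have "w \<in> insert v (dsc v)"
    using w rw in_root_path_self[OF p(3)] by (auto simp: dsc_def)
  ultimately show ?thesis by blast
qed

lemma pa_in_branch: "j \<in> dsc v \<Longrightarrow> pa j \<in> insert v (dsc v)"
  using parent_in_branch[of j v] pa_child by blast

text \<open>
  Rooting the tree orients every edge from parent to child, so the edge terms of the exponent can be
  indexed by the non-root vertices.
\<close>

lemma bij_betw_parent_edge: "bij_betw (\<lambda>j. {pa j, j}) (dsc r) E"
proof (rule bij_betwI')
  have ex: "\<exists>v. j \<in> ch v" if "j \<in> dsc r" for j
    using parent_in_branch[OF that] by blast
  show "{pa j, j} \<in> E" if "j \<in> dsc r" for j
    using ex[OF that] pa_child by (auto simp: ch_def)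
  show "({pa j, j} = {pa k, k}) = (j = k)" if jk: "j \<in> dsc r" "k \<in> dsc r" for j k
  proof
    assume eq: "{pa j, j} = {pa k, k}"
    show "j = k"
    proof (rule ccontr)
      assume "j \<noteq> k"
      with eq have "pa j = k" "pa k = j" by (auto simp: doubleton_eq_iff)
      with ex[OF jk(1)] ex[OF jk(2)] pa_child ch_asym show False by metis
    qed
  qed auto
  show "\<exists>j\<in>dsc r. e = {pa j, j}" if e_in: "e \<in> E" for e
  proof -
    obtain u v where e: "e = {u, v}" using edges[OF e_in] by (auto simp: card_2_iff)
    have D: "i \<in> dsc r" if i: "i \<in> ch w" for i w
    proof -
      have "i \<noteq> r"
        using i root_path_eq[of r "[r]"] root in_root_path_self[of w]
        by (auto simp: ch_iff is_path_def)
      thus ?thesis using i by (simp add: dsc_root ch_iff)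
    qed
    from edge_child[of u v] e_in e show ?thesis
      using pa_child D by (metis insert_commute)
  qed
qed

end


section \<open>Sums over configurations that factorize over blocks of coordinates\<close>

lemma sum_PiE_insert:
  assumes "a \<notin> A" "finite A" "finite S"
  shows "(\<Sum>x\<in>insert a A \<rightarrow>\<^sub>E S. h x) = (\<Sum>s\<in>S. \<Sum>y\<in>A \<rightarrow>\<^sub>E S. h (y(a := s)))"
proof -
  have "(\<Sum>x\<in>insert a A \<rightarrow>\<^sub>E S. h x) = (\<Sum>(s, y)\<in>S \<times> (A \<rightarrow>\<^sub>E S). h (y(a := s)))"
    unfolding PiE_insert_eq
    by (subst sum.reindex[OF inj_combinator[OF assms(1)]]) (auto simp: case_prod_unfold)
  thus ?thesis by (simp add: sum.cartesian_product)
qed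

lemma sum_PiE_Un:
  fixes h1 h2 :: "('v \<Rightarrow> 's) \<Rightarrow> 'c :: comm_semiring_1"
  assumes disj: "A \<inter> B = {}"
    and h1: "\<And>x y. (\<And>j. j \<in> A \<Longrightarrow> x j = y j) \<Longrightarrow> h1 x = h1 y"
    and h2: "\<And>x y. (\<And>j. j \<in> B \<Longrightarrow> x j = y j) \<Longrightarrow> h2 x = h2 y"
  shows "(\<Sum>x\<in>A \<union> B \<rightarrow>\<^sub>E S. h1 x * h2 x) = (\<Sum>x\<in>A \<rightarrow>\<^sub>E S. h1 x) * (\<Sum>x\<in>B \<rightarrow>\<^sub>E S. h2 x)"
proof -
  have "(\<Sum>x\<in>A \<union> B \<rightarrow>\<^sub>E S. h1 x * h2 x) = (\<Sum>(x, y)\<in>(A \<rightarrow>\<^sub>E S) \<times> (B \<rightarrow>\<^sub>E S). h1 x * h2 y)"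
  proof (rule sum.reindex_bij_witness[where
        i = "\<lambda>(x, y) j. if j \<in> A then x j else y j" and
        j = "\<lambda>x. (restrict x A, restrict x B)"])
    fix z assume "z \<in> (A \<rightarrow>\<^sub>E S) \<times> (B \<rightarrow>\<^sub>E S)"
    thus "(restrict ((\<lambda>(x, y) j. if j \<in> A then x j else y j) z) A,
         restrict ((\<lambda>(x, y) j. if j \<in> A then x j else y j) z) B) = z"
      using disj by (auto simp: fun_eq_iff restrict_def PiE_def extensional_def)
    show "(\<lambda>(x, y) j. if j \<in> A then x j else y j) z \<in> A \<union> B \<rightarrow>\<^sub>E S"
      using \<open>z \<in> _\<close> by (auto simp: PiE_def extensional_def)
  next
    fix x assume x: "x \<in> A \<union> B \<rightarrow>\<^sub>E S"
    show "(\<lambda>(x, y) j. if j \<in> A then x j else y j) (restrict x A, restrict x B) = x"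
      using x by (auto simp: fun_eq_iff PiE_def extensional_def)
    show "(restrict x A, restrict x B) \<in> (A \<rightarrow>\<^sub>E S) \<times> (B \<rightarrow>\<^sub>E S)"
      using x by auto
    have "h1 (restrict x A) = h1 x" by (rule h1) simp
    moreover have "h2 (restrict x B) = h2 x" by (rule h2) simp
    ultimately show "(case (restrict x A, restrict x B) of (x, y) \<Rightarrow> h1 x * h2 y) = h1 x * h2 x"
      by simp
  qed
  thus ?thesis by (simp add: sum_product sum.cartesian_product)
qed

text \<open>
  This is the distributive law behind message passing: factors that look at disjoint blocks of
  coordinates can be summed block by block.
\<close>

lemma sum_PiE_UN_disjoint:
  fixes h :: "'i \<Rightarrow> ('v \<Rightarrow> 's) \<Rightarrow> 'c :: comm_semiring_1"
  assumes "finite I"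
    and "\<And>i k. i \<in> I \<Longrightarrow> k \<in> I \<Longrightarrow> i \<noteq> k \<Longrightarrow> B i \<inter> B k = {}"
    and "\<And>i x y. i \<in> I \<Longrightarrow> (\<And>j. j \<in> B i \<Longrightarrow> x j = y j) \<Longrightarrow> h i x = h i y"
  shows "(\<Sum>x\<in>(\<Union>i\<in>I. B i) \<rightarrow>\<^sub>E S. \<Prod>i\<in>I. h i x) = (\<Prod>i\<in>I. \<Sum>x\<in>B i \<rightarrow>\<^sub>E S. h i x)"
  using assms
proof (induction I rule: finite_induct)
  case empty
  show ?case by simp
next
  case (insert k I)
  have "(\<Sum>x\<in>(\<Union>i\<in>insert k I. B i) \<rightarrow>\<^sub>E S. \<Prod>i\<in>insert k I. h i x)
      = (\<Sum>x\<in>B k \<union> (\<Union>i\<in>I. B i) \<rightarrow>\<^sub>E S. h k x * (\<Prod>i\<in>I. h i x))"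
    using insert.hyps by simp
  also have "\<dots> = (\<Sum>x\<in>B k \<rightarrow>\<^sub>E S. h k x) * (\<Sum>x\<in>(\<Union>i\<in>I. B i) \<rightarrow>\<^sub>E S. \<Prod>i\<in>I. h i x)"
  proof (rule sum_PiE_Un)
    show "B k \<inter> (\<Union>i\<in>I. B i) = {}"
      using insert.prems(1)[of k] insert.hyps by blast
    show "h k x = h k y" if "\<And>j. j \<in> B k \<Longrightarrow> x j = y j" for x y
      using insert.prems(2)[of k x y] that by simp
    show "(\<Prod>i\<in>I. h i x) = (\<Prod>i\<in>I. h i y)" if "\<And>j. j \<in> (\<Union>i\<in>I. B i) \<Longrightarrow> x j = y j" for x y
      using insert.prems(2)[of _ x y] that by (intro prod.cong) auto
  qed
  also have "(\<Sum>x\<in>(\<Union>i\<in>I. B i) \<rightarrow>\<^sub>E S. \<Prod>i\<in>I. h i x) = (\<Prod>i\<in>I. \<Sum>x\<in>B i \<rightarrow>\<^sub>E S. h i x)"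
    by (rule insert.IH; rule insert.prems; simp)
  finally show ?case using insert.hyps by simp
qed


section \<open>The sum-product recursion\<close>

context rooted_tree
begin

text \<open>
  The factor \<open>f j\<close> sits at the vertex \<open>j\<close>, and \<open>g j\<close> at the edge from \<open>pa j\<close> to \<open>j\<close>, with the state of
  the parent as first argument. The edge above \<open>v\<close> does not belong to the branch of \<open>v\<close>, so that
  at the root the weight is that of the whole configuration.
\<close>

definition branch_weight ::
  "('v \<Rightarrow> 's \<Rightarrow> real) \<Rightarrow> ('v \<Rightarrow> 's \<Rightarrow> 's \<Rightarrow> real) \<Rightarrow> 'v \<Rightarrow> ('v \<Rightarrow> 's) \<Rightarrow> real" where
  "branch_weight f g v x = f v (x v) * (\<Prod>j\<in>dsc v. g j (x (pa j)) (x j) * f j (x j))"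

definition branch_sum ::
  "'s set \<Rightarrow> ('v \<Rightarrow> 's \<Rightarrow> real) \<Rightarrow> ('v \<Rightarrow> 's \<Rightarrow> 's \<Rightarrow> real) \<Rightarrow> 'v \<Rightarrow> 's \<Rightarrow> real" where
  "branch_sum S f g v s = (\<Sum>x\<in>dsc v \<rightarrow>\<^sub>E S. branch_weight f g v (x(v := s)))"

definition partition_sum ::
  "'s set \<Rightarrow> ('v \<Rightarrow> 's \<Rightarrow> real) \<Rightarrow> ('v \<Rightarrow> 's \<Rightarrow> 's \<Rightarrow> real) \<Rightarrow> real" where
  "partition_sum S f g = (\<Sum>x\<in>V \<rightarrow>\<^sub>E S. branch_weight f g r x)"

text \<open>
  The message of belief propagation: what the branch of \<open>i\<close>, including the edge above it, contributes
  when the parent of \<open>i\<close> is in state \<open>s\<close>.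
\<close>

definition message ::
  "'s set \<Rightarrow> ('v \<Rightarrow> 's \<Rightarrow> real) \<Rightarrow> ('v \<Rightarrow> 's \<Rightarrow> 's \<Rightarrow> real) \<Rightarrow> 'v \<Rightarrow> 's \<Rightarrow> real" where
  "message S f g i s = (\<Sum>s'\<in>S. g i s s' * branch_sum S f g i s')"

lemma branch_weight_cong:
  assumes "\<And>j. j \<in> insert v (dsc v) \<Longrightarrow> x j = y j"
    and "\<And>j. j \<in> insert v (dsc v) \<Longrightarrow> f j = f' j"
  shows "branch_weight f g v x = branch_weight f' g v y"
  unfolding branch_weight_def
  using assms pa_in_branch by (intro arg_cong2[of _ _ _ _ "(*)"] prod.cong) auto

lemma branch_weight_children:
  "branch_weight f g v x
     = f v (x v) * (\<Prod>i\<in>ch v. g i (x v) (x i) * branch_weight f g i x)"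
proof -
  have "(\<Prod>j\<in>dsc v. g j (x (pa j)) (x j) * f j (x j))
      = (\<Prod>i\<in>ch v. \<Prod>j\<in>insert i (dsc i). g j (x (pa j)) (x j) * f j (x j))"
    using child_branches_disjoint finite_dsc
    by (subst dsc_eq_UN_children, intro prod.UNION_disjoint) (auto simp: finite_ch)
  also have "\<dots> = (\<Prod>i\<in>ch v. g i (x v) (x i) * branch_weight f g i x)"
    by (intro prod.cong) (auto simp: branch_weight_def finite_dsc dsc_irrefl pa_child)
  finally show ?thesis by (simp add: branch_weight_def)
qed

text \<open>
  Once the state of \<open>v\<close> is fixed, the branches of its children are disjoint and no factor connects
  them, so their sums separate.
\<close>

lemma branch_sum_rec:
  fixes f :: "'v \<Rightarrow> 's \<Rightarrow> real"
  assumes "finite S"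
  shows "branch_sum S f g v s = f v s * (\<Prod>i\<in>ch v. message S f g i s)"
proof -
  have "branch_sum S f g v s
      = (\<Sum>x\<in>dsc v \<rightarrow>\<^sub>E S. f v s * (\<Prod>i\<in>ch v. g i s (x i) * branch_weight f g i x))"
    unfolding branch_sum_def
  proof (rule sum.cong[OF refl])
    fix x
    have "branch_weight f g i (x(v := s)) = branch_weight f g i x" if "i \<in> ch v" for i
      using not_in_child_branch[OF that] by (intro branch_weight_cong) auto
    moreover have "(x(v := s)) i = x i" if "i \<in> ch v" for i
      using not_in_child_branch[OF that] by auto
    ultimately show "branch_weight f g v (x(v := s))
        = f v s * (\<Prod>i\<in>ch v. g i s (x i) * branch_weight f g i x)"
      by (simp add: branch_weight_children[of f g v])
  qed
  also have "\<dots> = f v s * (\<Sum>x\<in>dsc v \<rightarrow>\<^sub>E S. \<Prod>i\<in>ch v. g i s (x i) * branch_weight f g i x)"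
    by (simp add: sum_distrib_left)
  also have "(\<Sum>x\<in>dsc v \<rightarrow>\<^sub>E S. \<Prod>i\<in>ch v. g i s (x i) * branch_weight f g i x)
      = (\<Prod>i\<in>ch v. \<Sum>x\<in>insert i (dsc i) \<rightarrow>\<^sub>E S. g i s (x i) * branch_weight f g i x)"
    unfolding dsc_eq_UN_children[of v]
  proof (rule sum_PiE_UN_disjoint[OF finite_ch child_branches_disjoint])
    fix i and x y :: "'v \<Rightarrow> 's"
    assume "\<And>j. j \<in> insert i (dsc i) \<Longrightarrow> x j = y j"
    thus "g i s (x i) * branch_weight f g i x = g i s (y i) * branch_weight f g i y"
      using branch_weight_cong[of i x y f f g] by simp
  qed
  also have "\<dots> = (\<Prod>i\<in>ch v. message S f g i s)"
    by (simp add: sum_PiE_insert[OF dsc_irrefl finite_dsc assms] message_def branch_sum_def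
        sum_distrib_left)
  finally show ?thesis .
qed

lemma partition_sum_root:
  assumes "finite S"
  shows "partition_sum S f g = (\<Sum>s\<in>S. branch_sum S f g r s)"
proof -
  have "V = insert r (dsc r)" using root by (auto simp: dsc_root)
  thus ?thesis unfolding partition_sum_def branch_sum_def
    using sum_PiE_insert[OF dsc_irrefl finite_dsc assms] by metis
qed

lemma branch_sum_cong:
  assumes "\<And>j. j \<in> insert v (dsc v) \<Longrightarrow> f j = f' j"
  shows "branch_sum S f g v s = branch_sum S f' g v s"
  unfolding branch_sum_def using assms by (intro sum.cong branch_weight_cong) auto

lemma message_cong:
  assumes "\<And>j. j \<in> insert v (dsc v) \<Longrightarrow> f j = f' j"
  shows "message S f g v s = message S f' g v s"
  unfolding message_def using branch_sum_cong[OF assms] by simp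

lemma branch_sum_pos:
  assumes "finite S" "S \<noteq> {}"
    and "\<And>j s. s \<in> S \<Longrightarrow> 0 < f j s" "\<And>j s s'. s \<in> S \<Longrightarrow> s' \<in> S \<Longrightarrow> 0 < g j s s'"
    and "v \<in> V" "s \<in> S"
  shows "0 < branch_sum S f g v s"
  using assms(5,6)
proof (induction v arbitrary: s rule: tree_induct)
  case (vertex v)
  have "0 < message S f g i s" if "i \<in> ch v" for i
    unfolding message_def using vertex.IH[OF that] vertex.prems assms(1-4)
    by (intro sum_pos mult_pos_pos) auto
  thus ?case
    using vertex.prems assms(3) by (auto simp: branch_sum_rec[OF assms(1)] intro!: mult_pos_pos prod_pos)
qed

lemma message_pos:
  assumes "finite S" "S \<noteq> {}"
    and "\<And>j s. s \<in> S \<Longrightarrow> 0 < f j s" "\<And>j s s'. s \<in> S \<Longrightarrow> s' \<in> S \<Longrightarrow> 0 < g j s s'"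
    and "v \<in> V" "s \<in> S"
  shows "0 < message S f g v s"
  unfolding message_def
  by (intro sum_pos mult_pos_pos branch_sum_pos assms)

text \<open>
  The branch sum of a vertex enters those of its ancestors linearly: at each ancestor exactly one
  child leads to \<open>v\<close>, and the messages of the other children are unaffected by a change of factors
  below \<open>v\<close>. A constant gained at \<open>v\<close> is therefore carried up to the root.
\<close>

lemma partition_sum_scale:
  assumes S: "finite S" and v: "v \<in> V"
    and outside: "\<And>j. j \<notin> insert v (dsc v) \<Longrightarrow> f' j = f j"
    and scale: "\<And>s. s \<in> S \<Longrightarrow> branch_sum S f' g v s = c * branch_sum S f g v s"
  shows "partition_sum S f' g = c * partition_sum S f g"
proof -
  have "v \<in> insert u (dsc u) \<longrightarrow> branch_sum S f' g u s = c * branch_sum S f g u s"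
    if "u \<in> V" "s \<in> S" for u s
    using that
  proof (induction u arbitrary: s rule: tree_induct)
    case (vertex u)
    show ?case
    proof (intro impI)
      assume vu: "v \<in> insert u (dsc u)"
      show "branch_sum S f' g u s = c * branch_sum S f g u s"
      proof (cases "v = u")
        case True
        with scale vertex.prems show ?thesis by simp
      next
        case False
        with vu obtain k where k: "k \<in> ch u" "v \<in> insert k (dsc k)"
          using dsc_eq_UN_children[of u] by auto
        have sub: "insert v (dsc v) \<subseteq> insert k (dsc k)"
          using k(2) dsc_trans by auto
        have u: "u \<notin> insert k (dsc k)" by (rule not_in_child_branch[OF k(1)])
        have rest: "message S f' g i s = message S f g i s" if "i \<in> ch u - {k}" for i
        proof (rule message_cong)
          fix j assume "j \<in> insert i (dsc i)"
          with child_branches_disjoint[of i u k] that k sub have "j \<notin> insert v (dsc v)" by blast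
          thus "f' j = f j" by (rule outside)
        qed
        have "message S f' g k s = c * message S f g k s"
          unfolding message_def sum_distrib_left
          using vertex.IH[OF k(1)] k(2) by (intro sum.cong) (auto simp: mult.left_commute)
        moreover have "f' u = f u" using outside[of u] sub u by blast
        ultimately show ?thesis
          using rest by (simp add: branch_sum_rec[OF S] prod.remove[OF finite_ch k(1)])
      qed
    qed
  qed
  moreover have "v \<in> insert r (dsc r)" using v by (auto simp: dsc_root)
  ultimately show ?thesis
    unfolding partition_sum_root[OF S] sum_distrib_left using root by (intro sum.cong) auto
qed


section \<open>Marginals of a single vertex and of an edge\<close>

text \<open>
  Restricting the partition function to configurations with state \<open>s\<close> at \<open>v\<close> amounts to changing the
  vertex factor at \<open>v\<close>, so restricted sums are again partition functions of the same kind.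
\<close>

definition pin :: "'v \<Rightarrow> 's \<Rightarrow> ('v \<Rightarrow> 's \<Rightarrow> real) \<Rightarrow> 'v \<Rightarrow> 's \<Rightarrow> real" where
  "pin v s f = f(v := (\<lambda>x. if x = s then f v x else 0))"

text \<open>
  The conditional probability of state \<open>s'\<close> at \<open>i\<close> given state \<open>s\<close> at its parent, written in terms of
  the branch of \<open>i\<close> alone.
\<close>

definition transition ::
  "'s set \<Rightarrow> ('v \<Rightarrow> 's \<Rightarrow> real) \<Rightarrow> ('v \<Rightarrow> 's \<Rightarrow> 's \<Rightarrow> real) \<Rightarrow> 'v \<Rightarrow> 's \<Rightarrow> 's \<Rightarrow> real" where
  "transition S f g i s s' = g i s s' * branch_sum S f g i s' / message S f g i s"

lemma branch_weight_pin:
  assumes "v \<in> V"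
  shows "branch_weight (pin v s f) g r x = (if x v = s then branch_weight f g r x else 0)"
proof (cases "x v = s")
  case True
  thus ?thesis unfolding branch_weight_def pin_def
    by (auto intro!: arg_cong2[of _ _ _ _ "(*)"] prod.cong)
next
  case False
  show ?thesis
  proof (cases "v = r")
    case True
    thus ?thesis using False by (simp add: branch_weight_def pin_def)
  next
    case vr: False
    have "(\<Prod>j\<in>dsc r. g j (x (pa j)) (x j) * pin v s f j (x j)) = 0"
      using vr assms False
      by (intro prod_zero[OF finite_dsc] bexI[of _ v]) (simp_all add: dsc_root pin_def)
    thus ?thesis using False by (simp add: branch_weight_def)
  qed
qed

lemma partition_sum_pin:
  "v \<in> V \<Longrightarrow> partition_sum S (pin v s f) g
     = (\<Sum>x\<in>V \<rightarrow>\<^sub>E S. if x v = s then branch_weight f g r x else 0)"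
  by (simp add: partition_sum_def branch_weight_pin)

lemma sum_partition_sum_pin:
  assumes "finite S" "v \<in> V"
  shows "(\<Sum>s\<in>S. partition_sum S (pin v s f) g) = partition_sum S f g"
proof -
  have "(\<Sum>s\<in>S. partition_sum S (pin v s f) g)
      = (\<Sum>x\<in>V \<rightarrow>\<^sub>E S. \<Sum>s\<in>S. if x v = s then branch_weight f g r x else 0)"
    by (simp add: partition_sum_pin[OF assms(2)] sum.swap[of _ S])
  also have "\<dots> = partition_sum S f g"
    unfolding partition_sum_def using assms by (intro sum.cong) (auto simp: PiE_mem)
  finally show ?thesis .
qed

lemma branch_sum_pin:
  assumes "finite S"
  shows "branch_sum S (pin v s f) g v s' = (if s' = s then branch_sum S f g v s' else 0)"
proof -
  have "message S (pin v s f) g i s' = message S f g i s'" if "i \<in> ch v" for i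
    using not_in_child_branch[OF that] by (intro message_cong) (auto simp: pin_def)
  thus ?thesis by (simp add: branch_sum_rec[OF assms] pin_def)
qed

lemma partition_sum_pin_root:
  assumes "finite S" "s \<in> S"
  shows "partition_sum S (pin r s f) g = branch_sum S f g r s"
  using assms by (simp add: partition_sum_root branch_sum_pin)

text \<open>
  The joint weight of a parent and a child is the weight of the parent times the transition. Both
  sides agree at \<open>v\<close> because pinning \<open>i\<close> keeps a single term of its message, and
  \<open>partition_sum_scale\<close> lifts this to the root.
\<close>

lemma partition_sum_pin_edge:
  assumes S: "finite S" and i: "i \<in> ch v" and s': "s' \<in> S" and m: "message S f g i s \<noteq> 0"
  shows "partition_sum S (pin i s' (pin v s f)) g
           = transition S f g i s s' * partition_sum S (pin v s f) g"
proof (rule partition_sum_scale[OF S])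
  show "v \<in> V" using i by (simp add: ch_iff)
  have iv: "i \<noteq> v" and ch: "i \<in> dsc v" using i not_in_child_branch[OF i] ch_subset_dsc by auto
  show "pin i s' (pin v s f) j = pin v s f j" if "j \<notin> insert v (dsc v)" for j
    using that ch by (auto simp: pin_def)
  fix s2 assume "s2 \<in> S"
  show "branch_sum S (pin i s' (pin v s f)) g v s2
          = transition S f g i s s' * branch_sum S (pin v s f) g v s2"
  proof (cases "s2 = s")
    case False
    thus ?thesis using iv by (simp add: branch_sum_rec[OF S] pin_def)
  next
    case True
    have rest: "message S (pin i s' (pin v s f)) g k s = message S (pin v s f) g k s"
      if "k \<in> ch v - {i}" for k
      using child_branches_disjoint[of i v k] that i
      by (intro message_cong) (auto simp: pin_def)
    have f: "message S (pin v s f) g i s = message S f g i s"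
      "branch_sum S (pin v s f) g i s' = branch_sum S f g i s'"
      using not_in_child_branch[OF i]
      by (auto intro!: message_cong branch_sum_cong simp: pin_def)
    have "message S (pin i s' (pin v s f)) g i s = g i s s' * branch_sum S (pin v s f) g i s'"
      using S s' by (simp add: message_def branch_sum_pin[OF S] if_distrib cong: if_cong)
    also have "\<dots> = transition S f g i s s' * message S (pin v s f) g i s"
      using m by (simp add: f transition_def)
    finally show ?thesis
      using rest iv True
      by (simp add: branch_sum_rec[OF S, of _ _ v] prod.remove[OF finite_ch i] pin_def)
  qed
qed

lemma sum_transition:
  "message S f g i s \<noteq> 0 \<Longrightarrow> (\<Sum>s'\<in>S. transition S f g i s s') = 1"
  unfolding transition_def sum_divide_distrib[symmetric] message_def[symmetric] by (rule divide_self)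


section \<open>Recursion for generating functions\<close>

text \<open>
  Weighting the states by \<open>t\<close> multiplies the message of \<open>i\<close> by the mean of the weighted branch under
  the transition from the state of the parent: this is \<open>zeta\<close> for a parent in state 0 and \<open>xi\<close> for a
  parent in state 1.
\<close>

lemma branch_sum_zeta_xi:
  fixes f :: "'v \<Rightarrow> nat \<Rightarrow> real" and g :: "'v \<Rightarrow> nat \<Rightarrow> nat \<Rightarrow> real"
  assumes nz: "\<And>i s. i \<in> V \<Longrightarrow> s \<in> {0, 1} \<Longrightarrow> message {0, 1} f g i s \<noteq> 0"
    and T0: "\<And>i v. i \<in> ch v \<Longrightarrow>
      transition {0, 1} f g i 0 1 = q i - \<alpha> {v, i} * edge_sigma q v i / (1 - q v)"
    and T1: "\<And>i v. i \<in> ch v \<Longrightarrow>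
      transition {0, 1} f g i 1 1 = q i + \<alpha> {v, i} * edge_sigma q v i / q v"
    and v: "v \<in> V" and s: "s \<in> {0, 1}"
  shows "branch_sum {0, 1} (\<lambda>v s. f v s * t v ^ s) g v s
    = branch_sum {0, 1} f g v s * (t v ^ s
        * (\<Prod>i\<in>ch v. if s = 0 then zeta q \<alpha> t i else xi q \<alpha> t i))"
  using v s
proof (induction v arbitrary: s rule: tree_induct)
  case (vertex v)
  let ?S = "{0, 1 :: nat}" and ?h = "\<lambda>v s. f v s * t v ^ s"
  have eq: "message ?S ?h g i s
      = message ?S f g i s * (if s = 0 then zeta q \<alpha> t i else xi q \<alpha> t i)"
    if i: "i \<in> ch v" for i
  proof -
    let ?Z = "\<Prod>k\<in>ch i. zeta q \<alpha> t k" and ?X = "t i * (\<Prod>k\<in>ch i. xi q \<alpha> t k)"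
    let ?T = "transition ?S f g i s"
    have m: "message ?S f g i s \<noteq> 0" by (rule nz[OF child_in_V[OF i] vertex.prems])
    have "message ?S ?h g i s
        = g i s 0 * branch_sum ?S f g i 0 * ?Z + g i s 1 * branch_sum ?S f g i 1 * ?X"
      using vertex.IH[OF i, of 0] vertex.IH[OF i, of 1] by (simp add: message_def)
    also have "\<dots> = message ?S f g i s * (?T 0 * ?Z + ?T 1 * ?X)"
      using m by (simp add: transition_def field_simps)
    finally have "message ?S ?h g i s = message ?S f g i s * (?T 0 * ?Z + ?T 1 * ?X)" .
    moreover have "?T 0 = 1 - ?T 1"
      using sum_transition[OF m] by simp
    ultimately have *: "message ?S ?h g i s = message ?S f g i s * ((1 - ?T 1) * ?Z + ?T 1 * ?X)"
      by (simp only:)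
    have "(1 - ?T 1) * ?Z + ?T 1 * ?X = (if s = 0 then zeta q \<alpha> t i else xi q \<alpha> t i)"
    proof (cases "s = 0")
      case True
      show ?thesis
        unfolding True T0[OF i] zeta.simps[of _ _ _ i] pa_child[OF i] by (simp add: algebra_simps)
    next
      case False
      hence s1: "s = 1" using vertex.prems by simp
      show ?thesis
        unfolding s1 T1[OF i] xi.simps[of _ _ _ i] pa_child[OF i] by (simp add: algebra_simps)
    qed
    with * show ?thesis by (simp only:)
  qed
  have S: "finite ?S" by simp
  have "(\<Prod>i\<in>ch v. message ?S ?h g i s)
    = (\<Prod>i\<in>ch v. message ?S f g i s) * (\<Prod>i\<in>ch v. if s = 0 then zeta q \<alpha> t i else xi q \<alpha> t i)"
    unfolding prod.distrib[symmetric] by (rule prod.cong[OF refl eq])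
  thus ?case unfolding branch_sum_rec[OF S] by (simp only: ac_simps)
qed

lemma branch_weight_mult:
  assumes "\<And>v. h v = (\<lambda>s. f v s * p v s)"
  shows "branch_weight h g r x = branch_weight f g r x * (\<Prod>v\<in>V. p v (x v))"
proof -
  have "(\<Prod>v\<in>V. p v (x v)) = p r (x r) * (\<Prod>v\<in>dsc r. p v (x v))"
    unfolding dsc_root using finite_V root by (rule prod.remove)
  thus ?thesis by (simp add: branch_weight_def assms prod.distrib algebra_simps)
qed

text \<open>
  An arbitrary root turns the undirected Gibbs weight into the directed product form, with the edge
  parameters attached to the lower end of each edge.
\<close>

lemma exp_ising_exponent:
  "exp (ising_exponent V E \<eta> \<theta> x)
    = branch_weight (\<lambda>v s. exp (\<eta> v * real s)) (\<lambda>j s s'. exp (\<theta> {pa j, j} * (real s * real s'))) r x"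
proof -
  have ne: "pa j \<noteq> j" if "j \<in> dsc r" for j
    using bij_betw_parent_edge that edge_vertices[of "pa j" j] by (auto simp: bij_betw_def)
  have "(\<Sum>e\<in>E. \<theta> e * (\<Prod>v\<in>e. real (x v)))
      = (\<Sum>j\<in>dsc r. \<theta> {pa j, j} * (\<Prod>v\<in>{pa j, j}. real (x v)))"
    by (rule sum.reindex_bij_betw[OF bij_betw_parent_edge, symmetric])
  also have "\<dots> = (\<Sum>j\<in>dsc r. \<theta> {pa j, j} * (real (x (pa j)) * real (x j)))"
    using ne by (intro sum.cong) auto
  finally have "(\<Sum>e\<in>E. \<theta> e * (\<Prod>v\<in>e. real (x v)))
    = (\<Sum>j\<in>dsc r. \<theta> {pa j, j} * (real (x (pa j)) * real (x j)))" .
  moreover have "(\<Sum>v\<in>V. \<eta> v * real (x v)) = \<eta> r * real (x r) + (\<Sum>v\<in>dsc r. \<eta> v * real (x v))"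
    unfolding dsc_root using finite_V root by (rule sum.remove)
  ultimately show ?thesis
    by (simp add: ising_exponent_def branch_weight_def exp_add exp_sum finite_dsc prod.distrib
        algebra_simps)
qed

end


section \<open>Expectations of functions of finitely many binary variables\<close>

context prob_space
begin

text \<open>
  The events on which the family equals a given configuration partition the space. Restricting the
  family to \<open>V\<close> makes it extensional, so that it is itself one of the summation indices.
\<close>

lemma expectation_binary_family:
  fixes J :: "'v \<Rightarrow> 'a \<Rightarrow> nat" and h :: "('v \<Rightarrow> nat) \<Rightarrow> real"
  assumes V: "finite V" and J: "\<And>v. v \<in> V \<Longrightarrow> random_variable (count_space {0, 1}) (J v)"
  shows "expectation (\<lambda>\<omega>. h (restrict (\<lambda>v. J v \<omega>) V))
    = (\<Sum>x\<in>V \<rightarrow>\<^sub>E {0, 1}. prob {\<omega> \<in> space M. \<forall>v\<in>V. J v \<omega> = x v} * h x)"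
proof -
  let ?A = "\<lambda>x. {\<omega> \<in> space M. \<forall>v\<in>V. J v \<omega> = x v}"
  have A: "?A x \<in> events" for x
  proof -
    have "{\<omega> \<in> space M. J v \<omega> = x v} \<in> events" if "v \<in> V" for v
    proof -
      have "{\<omega> \<in> space M. J v \<omega> = x v} = J v -` ({x v} \<inter> {0, 1}) \<inter> space M"
        using measurable_space[OF J[OF that]] by auto
      thus ?thesis using measurable_sets[OF J[OF that], of "{x v} \<inter> {0, 1}"] by simp
    qed
    thus ?thesis using V by (intro sets.sets_Collect_finite_All) auto
  qed
  have fin: "finite (V \<rightarrow>\<^sub>E {0, 1 :: nat})" using V by (intro finite_PiE) auto
  have "expectation (\<lambda>\<omega>. h (restrict (\<lambda>v. J v \<omega>) V))
      = expectation (\<lambda>\<omega>. \<Sum>x\<in>V \<rightarrow>\<^sub>E {0, 1}. indicator (?A x) \<omega> * h x)"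
  proof (rule Bochner_Integration.integral_cong[OF refl])
    fix \<omega> assume \<omega>: "\<omega> \<in> space M"
    let ?y = "restrict (\<lambda>v. J v \<omega>) V"
    have y: "?y \<in> V \<rightarrow>\<^sub>E {0, 1}"
      using measurable_space[OF J \<omega>] by auto
    have "(\<Sum>x\<in>V \<rightarrow>\<^sub>E {0, 1}. indicator (?A x) \<omega> * h x)
        = (\<Sum>x\<in>V \<rightarrow>\<^sub>E {0, 1}. if x = ?y then h x else 0)"
    proof (rule sum.cong[OF refl])
      fix x assume x: "x \<in> V \<rightarrow>\<^sub>E {0, 1 :: nat}"
      have "\<omega> \<in> ?A x \<longleftrightarrow> x = ?y"
        using \<omega> x y by (auto simp: fun_eq_iff PiE_def extensional_def restrict_def)
      thus "indicator (?A x) \<omega> * h x = (if x = ?y then h x else 0)" by (simp add: indicator_def)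
    qed
    also have "\<dots> = h ?y" using fin y by simp
    finally show "h ?y = (\<Sum>x\<in>V \<rightarrow>\<^sub>E {0, 1}. indicator (?A x) \<omega> * h x)" by simp
  qed
  also have "\<dots> = (\<Sum>x\<in>V \<rightarrow>\<^sub>E {0, 1}. prob (?A x) * h x)"
    using A by (subst Bochner_Integration.integral_sum)
      (auto intro!: integrable_mult_left integrable_real_indicator simp: emeasure_eq_measure)
  finally show ?thesis .
qed

text \<open>
  A binary variable equals its square, so its mean determines its variance, and the correlation then
  gives the mixed moment.
\<close>

lemma binary_expectation_product:
  fixes X Y :: "'a \<Rightarrow> nat"
  assumes X: "random_variable (count_space {0, 1}) X" and Y: "random_variable (count_space {0, 1}) Y"
    and EX: "expectation (\<lambda>\<omega>. real (X \<omega>)) = a" and EY: "expectation (\<lambda>\<omega>. real (Y \<omega>)) = b"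
    and a: "0 < a" "a < 1" and b: "0 < b" "b < 1"
  shows "expectation (\<lambda>\<omega>. real (X \<omega>) * real (Y \<omega>))
    = a * b + correlation (\<lambda>\<omega>. real (X \<omega>)) (\<lambda>\<omega>. real (Y \<omega>)) * sqrt (a * b * (1 - a) * (1 - b))"
proof -
  have X01: "X \<omega> \<in> {0, 1}" if "\<omega> \<in> space M" for \<omega> using measurable_space[OF X that] by simp
  have Y01: "Y \<omega> \<in> {0, 1}" if "\<omega> \<in> space M" for \<omega> using measurable_space[OF Y that] by simp
  have mX: "(\<lambda>\<omega>. real (X \<omega>)) \<in> borel_measurable M"
    using measurable_compose[OF X, of real borel] by simp
  have mY: "(\<lambda>\<omega>. real (Y \<omega>)) \<in> borel_measurable M"
    using measurable_compose[OF Y, of real borel] by simp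
  have iX: "integrable M (\<lambda>\<omega>. real (X \<omega>))"
    using X01 mX by (intro integrable_const_bound[of _ 1] AE_I2) fastforce+
  have iY: "integrable M (\<lambda>\<omega>. real (Y \<omega>))"
    using Y01 mY by (intro integrable_const_bound[of _ 1] AE_I2) fastforce+
  have iXY: "integrable M (\<lambda>\<omega>. real (X \<omega>) * real (Y \<omega>))"
  proof (rule integrable_const_bound[of _ 1])
    show "AE \<omega> in M. norm (real (X \<omega>) * real (Y \<omega>)) \<le> 1"
    proof (rule AE_I2)
      fix \<omega> assume "\<omega> \<in> space M"
      from X01[OF this] Y01[OF this] show "norm (real (X \<omega>) * real (Y \<omega>)) \<le> 1" by auto
    qed
  qed (use mX mY in measurable)
  have vX: "variance (\<lambda>\<omega>. real (X \<omega>)) = a * (1 - a)"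
  proof -
    have "variance (\<lambda>\<omega>. real (X \<omega>)) = expectation (\<lambda>\<omega>. (1 - 2 * a) * real (X \<omega>) + a\<^sup>2)"
      unfolding EX
      by (rule Bochner_Integration.integral_cong[OF refl], drule X01)
         (auto simp: power2_eq_square algebra_simps)
    also have "\<dots> = a * (1 - a)" using iX by (simp add: EX prob_space power2_eq_square algebra_simps)
    finally show ?thesis .
  qed
  have vY: "variance (\<lambda>\<omega>. real (Y \<omega>)) = b * (1 - b)"
  proof -
    have "variance (\<lambda>\<omega>. real (Y \<omega>)) = expectation (\<lambda>\<omega>. (1 - 2 * b) * real (Y \<omega>) + b\<^sup>2)"
      unfolding EY
      by (rule Bochner_Integration.integral_cong[OF refl], drule Y01)
         (auto simp: power2_eq_square algebra_simps)
    also have "\<dots> = b * (1 - b)" using iY by (simp add: EY prob_space power2_eq_square algebra_simps)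
    finally show ?thesis .
  qed
  have "expectation (\<lambda>\<omega>. (real (X \<omega>) - a) * (real (Y \<omega>) - b))
      = expectation (\<lambda>\<omega>. real (X \<omega>) * real (Y \<omega>) - b * real (X \<omega>) - a * real (Y \<omega>) + a * b)"
    by (rule Bochner_Integration.integral_cong[OF refl]) (simp add: algebra_simps)
  also have "\<dots> = expectation (\<lambda>\<omega>. real (X \<omega>) * real (Y \<omega>)) - a * b"
    using iX iY iXY by (simp add: EX EY prob_space algebra_simps)
  finally have cov: "expectation (\<lambda>\<omega>. (real (X \<omega>) - a) * (real (Y \<omega>) - b))
    = expectation (\<lambda>\<omega>. real (X \<omega>) * real (Y \<omega>)) - a * b" .
  have eq: "a * (1 - a) * (b * (1 - b)) = a * b * (1 - a) * (1 - b)" by (simp add: algebra_simps)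
  have "sqrt (a * b * (1 - a) * (1 - b)) \<noteq> 0" using a b by simp
  thus ?thesis unfolding correlation_def vX vY unfolding EX EY cov eq by simp
qed

end


section \<open>The joint probability generating function\<close>

text \<open>
  The normalizing constant \<open>Z\<close> is carried along until it cancels, both from the equations for the
  transitions and from the generating function.
\<close>

lemma (in rooted_tree) ising_joint_pgf:
  fixes q :: "'v \<Rightarrow> real" and J :: "'v \<Rightarrow> 'a \<Rightarrow> nat"
  assumes M: "prob_space M" and q: "\<And>v. v \<in> V \<Longrightarrow> 0 < q v \<and> q v < 1"
    and ising: "prob_space.ising_model M V E q \<alpha> J"
  shows "prob_space.joint_pgf M V J t
    = (1 - q r) * (\<Prod>i\<in>ch r. zeta q \<alpha> t i) + q r * t r * (\<Prod>i\<in>ch r. xi q \<alpha> t i)"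
proof -
  interpret prob_space M by (rule M)
  let ?S = "{0, 1 :: nat}"
  have J: "\<And>v. v \<in> V \<Longrightarrow> random_variable (count_space ?S) (J v)"
    and mean: "\<And>v. v \<in> V \<Longrightarrow> expectation (\<lambda>\<omega>. real (J v \<omega>)) = q v"
    and corr: "\<And>u v. {u, v} \<in> E \<Longrightarrow> correlation (\<lambda>\<omega>. real (J u \<omega>)) (\<lambda>\<omega>. real (J v \<omega>)) = \<alpha> {u, v}"
    using ising by (simp_all add: ising_model_def)
  have "\<exists>\<eta> \<theta>. \<forall>x \<in> V \<rightarrow>\<^sub>E ?S. prob {\<omega> \<in> space M. \<forall>v\<in>V. J v \<omega> = x v}
        = exp (ising_exponent V E \<eta> \<theta> x - log_partition V E \<eta> \<theta>)"
    using ising by (simp only: ising_model_def)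
  then obtain \<eta> \<theta> where pmf: "\<forall>x \<in> V \<rightarrow>\<^sub>E ?S. prob {\<omega> \<in> space M. \<forall>v\<in>V. J v \<omega> = x v}
        = exp (ising_exponent V E \<eta> \<theta> x - log_partition V E \<eta> \<theta>)"
    by (elim exE)
  define f where "f = (\<lambda>(v :: 'v) (s :: nat). exp (\<eta> v * real s))"
  define g where "g = (\<lambda>(j :: 'v) (s :: nat) (s' :: nat). exp (\<theta> {pa j, j} * (real s * real s')))"
  define Z where "Z = partition_sum ?S f g"
  have S: "finite ?S" "?S \<noteq> {}" by auto
  have fg: "0 < f j s" "0 < g j s s'" for j s s' by (auto simp: f_def g_def)
  have m: "message ?S f g i s \<noteq> 0" if "i \<in> V" "s \<in> ?S" for i s
    using message_pos[of ?S f g i s] that fg by simp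
  have Z: "0 < Z"
    unfolding Z_def partition_sum_root[OF S(1)]
    using branch_sum_pos[of ?S f g r] fg root by (intro sum_pos) auto
  have Zln: "log_partition V E \<eta> \<theta> = ln Z"
    unfolding log_partition_def Z_def partition_sum_def exp_ising_exponent f_def g_def ..
  have expect: "expectation (\<lambda>\<omega>. h (restrict (\<lambda>v. J v \<omega>) V))
      = (\<Sum>x\<in>V \<rightarrow>\<^sub>E ?S. branch_weight f g r x * h x) / Z" for h :: "('v \<Rightarrow> nat) \<Rightarrow> real"
  proof -
    have pr: "prob {\<omega> \<in> space M. \<forall>v\<in>V. J v \<omega> = x v} = branch_weight f g r x / Z"
      if "x \<in> V \<rightarrow>\<^sub>E ?S" for x
      using Z by (simp add: pmf[rule_format, OF that] Zln exp_diff exp_ising_exponent f_def g_def)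
    have "expectation (\<lambda>\<omega>. h (restrict (\<lambda>v. J v \<omega>) V))
        = (\<Sum>x\<in>V \<rightarrow>\<^sub>E ?S. prob {\<omega> \<in> space M. \<forall>v\<in>V. J v \<omega> = x v} * h x)"
      by (rule expectation_binary_family[OF finite_V J])
    also have "\<dots> = (\<Sum>x\<in>V \<rightarrow>\<^sub>E ?S. branch_weight f g r x * h x / Z)"
      by (rule sum.cong[OF refl]) (simp only: pr times_divide_eq_left)
    finally show ?thesis by (simp only: sum_divide_distrib)
  qed
  \<comment> \<open>the means prescribe the weights of all one-vertex marginals, the correlations those of the edges\<close>
  have q1: "partition_sum ?S (pin v 1 f) g = q v * Z" if v: "v \<in> V" for v
  proof -
    have "q v = (\<Sum>x\<in>V \<rightarrow>\<^sub>E ?S. branch_weight f g r x * real (x v)) / Z"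
      using mean[OF v] expect[of "\<lambda>x. real (x v)"] v by simp
    also have "(\<Sum>x\<in>V \<rightarrow>\<^sub>E ?S. branch_weight f g r x * real (x v))
        = partition_sum ?S (pin v 1 f) g"
      unfolding partition_sum_pin[OF v]
    proof (rule sum.cong[OF refl])
      fix x assume "x \<in> V \<rightarrow>\<^sub>E ?S"
      hence "x v \<in> ?S" using v by (rule PiE_mem)
      thus "branch_weight f g r x * real (x v) = (if x v = 1 then branch_weight f g r x else 0)"
        by auto
    qed
    finally show ?thesis using Z by (simp add: field_simps)
  qed
  have q0: "partition_sum ?S (pin v 0 f) g = (1 - q v) * Z" if v: "v \<in> V" for v
    using sum_partition_sum_pin[OF S(1) v, of f g] q1[OF v] by (simp add: Z_def algebra_simps)
  have q11: "partition_sum ?S (pin i 1 (pin v 1 f)) g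
      = (q v * q i + \<alpha> {v, i} * edge_sigma q v i) * Z" if i: "i \<in> ch v" for i v
  proof -
    have vi: "v \<in> V" "i \<in> V" using i by (auto simp: ch_iff)
    have edge: "{v, i} \<in> E" using i by (simp add: ch_def)
    have "q v * q i + \<alpha> {v, i} * edge_sigma q v i = expectation (\<lambda>\<omega>. real (J v \<omega>) * real (J i \<omega>))"
      using binary_expectation_product[OF J[OF vi(1)] J[OF vi(2)] mean[OF vi(1)] mean[OF vi(2)]]
        q[OF vi(1)] q[OF vi(2)] corr[OF edge] by (simp add: edge_sigma_def)
    also have "\<dots> = (\<Sum>x\<in>V \<rightarrow>\<^sub>E ?S. branch_weight f g r x * (real (x v) * real (x i))) / Z"
      using expect[of "\<lambda>x. real (x v) * real (x i)"] vi by simp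
    also have "(\<Sum>x\<in>V \<rightarrow>\<^sub>E ?S. branch_weight f g r x * (real (x v) * real (x i)))
        = partition_sum ?S (pin i 1 (pin v 1 f)) g"
      unfolding partition_sum_pin[OF vi(2)]
    proof (rule sum.cong[OF refl])
      fix x assume "x \<in> V \<rightarrow>\<^sub>E ?S"
      hence "x v \<in> ?S" "x i \<in> ?S" using vi PiE_mem by metis+
      thus "branch_weight f g r x * (real (x v) * real (x i))
          = (if x i = 1 then branch_weight (pin v 1 f) g r x else 0)"
        by (auto simp: branch_weight_pin[OF vi(1)])
    qed
    finally show ?thesis using Z by (simp add: field_simps)
  qed
  have T1: "transition ?S f g i 1 1 = q i + \<alpha> {v, i} * edge_sigma q v i / q v"
    if i: "i \<in> ch v" for i v
  proof -
    have vi: "v \<in> V" "i \<in> V" using i by (auto simp: ch_iff)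
    have "(q v * q i + \<alpha> {v, i} * edge_sigma q v i) * Z = transition ?S f g i 1 1 * (q v * Z)"
      unfolding q11[OF i, symmetric] q1[OF vi(1), symmetric]
      by (rule partition_sum_pin_edge[OF S(1) i _ m[OF vi(2)]]) simp_all
    hence "q v * q i + \<alpha> {v, i} * edge_sigma q v i = transition ?S f g i 1 1 * q v"
      using Z by (metis mult.assoc mult_right_cancel less_irrefl)
    thus ?thesis using q[OF vi(1)] by (simp add: field_simps)
  qed
  have T0: "transition ?S f g i 0 1 = q i - \<alpha> {v, i} * edge_sigma q v i / (1 - q v)"
    if i: "i \<in> ch v" for i v
  proof -
    have vi: "v \<in> V" "i \<in> V" using i by (auto simp: ch_iff)
    have iv: "i \<noteq> v" using not_in_child_branch[OF i] by auto
    \<comment> \<open>the weight of state 0 at \<open>v\<close> and 1 at \<open>i\<close> is what remains of the weight of state 1 at \<open>i\<close>\<close>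
    have swap: "pin i 1 (pin v s f) = pin v s (pin i 1 f)" for s
      using iv by (auto simp: pin_def fun_eq_iff)
    have "partition_sum ?S (pin i 1 (pin v 0 f)) g + partition_sum ?S (pin i 1 (pin v 1 f)) g
        = q i * Z"
      using sum_partition_sum_pin[OF S(1) vi(1), of "pin i 1 f" g] q1[OF vi(2)]
      unfolding swap by simp
    moreover have "partition_sum ?S (pin i 1 (pin v 0 f)) g
        = transition ?S f g i 0 1 * partition_sum ?S (pin v 0 f) g"
      by (rule partition_sum_pin_edge[OF S(1) i _ m[OF vi(2)]]) simp_all
    ultimately have "transition ?S f g i 0 1 * ((1 - q v) * Z)
        = (q i - (q v * q i + \<alpha> {v, i} * edge_sigma q v i)) * Z"
      unfolding q11[OF i] q0[OF vi(1)] left_diff_distrib[of "q i"] by linarith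
    hence "transition ?S f g i 0 1 * (1 - q v) = q i - (q v * q i + \<alpha> {v, i} * edge_sigma q v i)"
      using Z by (metis mult.assoc mult_right_cancel less_irrefl)
    thus ?thesis using q[OF vi(1)] by (simp add: field_simps)
  qed
  \<comment> \<open>nothing lies above the root, so its branch sums are its marginal weights\<close>
  have root_law: "branch_sum ?S f g r 0 = (1 - q r) * Z" "branch_sum ?S f g r 1 = q r * Z"
    using partition_sum_pin_root[OF S(1), of _ f g] q0[OF root] q1[OF root] by auto
  have "joint_pgf V J t = (\<Sum>x\<in>V \<rightarrow>\<^sub>E ?S. branch_weight f g r x * (\<Prod>v\<in>V. t v ^ x v)) / Z"
    unfolding joint_pgf_def using expect[of "\<lambda>x. \<Prod>v\<in>V. t v ^ x v"] by simp
  also have "\<dots> = partition_sum ?S (\<lambda>v s. f v s * t v ^ s) g / Z"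
    unfolding partition_sum_def
    by (simp add: branch_weight_mult[where f = f and p = "\<lambda>v s. t v ^ s"])
  also have "partition_sum ?S (\<lambda>v s. f v s * t v ^ s) g
      = (\<Sum>s\<in>?S. branch_sum ?S f g r s
          * (t r ^ s * (\<Prod>i\<in>ch r. if s = 0 then zeta q \<alpha> t i else xi q \<alpha> t i)))"
    unfolding partition_sum_root[OF S(1)]
    by (intro sum.cong refl branch_sum_zeta_xi m T0 T1 root)
  also have "\<dots> = ((1 - q r) * (\<Prod>i\<in>ch r. zeta q \<alpha> t i) + q r * t r * (\<Prod>i\<in>ch r. xi q \<alpha> t i)) * Z"
    by (simp add: root_law[unfolded One_nat_def] algebra_simps)
  also have "\<dots> / Z = (1 - q r) * (\<Prod>i\<in>ch r. zeta q \<alpha> t i) + q r * t r * (\<Prod>i\<in>ch r. xi q \<alpha> t i)"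
    using Z by simp
  finally show ?thesis .
qed

theorem theorem1:
  fixes d :: nat and E :: "nat set set" and r :: nat
    and q :: "nat \<Rightarrow> real" and \<alpha> :: "nat set \<Rightarrow> real"
    and M :: "'a measure" and J :: "nat \<Rightarrow> 'a \<Rightarrow> nat" and t :: "nat \<Rightarrow> real"
  assumes "tree_graph {1..d} E"
    and "\<forall>v\<in>{1..d}. 0 < q v \<and> q v < 1"
    and "\<alpha> \<in> Lambda_set E q"
    and "prob_space M"
    and "prob_space.ising_model M {1..d} E q \<alpha> J"
    and "r \<in> {1..d}"
    and "\<forall>v\<in>{1..d}. t v \<in> {-1..1}"
  shows "prob_space.joint_pgf M {1..d} J t =
    (1 - q r) * (\<Prod>i\<in>rooted_tree.ch {1..d} E r r. rooted_tree.zeta {1..d} E r q \<alpha> t i)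
    + q r * t r * (\<Prod>i\<in>rooted_tree.ch {1..d} E r r. rooted_tree.xi {1..d} E r q \<alpha> t i)"
proof -
  interpret rooted_tree "{1..d}" E r
    using assms(1,6) by (simp add: rooted_tree_def rooted_tree_axioms_def)
  show ?thesis using ising_joint_pgf[OF assms(4)] assms(2,5) by blast
qed

end
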